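(* Let $k\ge1$. No memoryless randomized algorithm can achieve a competitive ratio better than $2k$ for unweighted any-order interval selection with revocable decisions on instances with at most $k$ distinct lengths. More specifically, for every memoryless randomized algorithm and every $p\in(0,1]$ there exists $\epsilon_p>0$ and an instance with at most $k$ distinct lengths (with an arrival order) such that, with probability $p$, the ratio $\mathrm{OPT}/\mathrm{ALG}$ is greater than $2k-\epsilon_p$.
   Context: Intervals are half-open $[s_i,f_i)$ with $s_i<f_i$ real; two intervals conflict if they intersect. Intervals arrive online in an adversarial order; on each arrival the algorithm decides immediately, maintaining a set of pairwise non-conflicting intervals; it may accept the new interval while discarding currently held intervals conflicting with it, and discarded or rejected intervals can never be taken again. A randomized algorithm is memoryless if a newly arrived interval $I_{new}$ is taken with probability $F(I_{new},S)$, where $S$ is the set of intervals currently in its solution, each interval being given as the pair $(s_i,f_i)$; i.e., the decision uses only the new interval, the current solution, and fresh random bits of the current step (no information or random bits from previous steps). $\mathrm{ALG}$ is the number of intervals in the final solution and $\mathrm{OPT}$ the maximum number of pairwise non-conflicting intervals of the instance. *)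

theory Defs
  imports "HOL-Probability.Probability"
begin

text \<open>An interval [s, f) is the pair (s, f).\<close>

type_synonym interval = "real \<times> real"

definition conflict :: "interval \<Rightarrow> interval \<Rightarrow> bool" where
  "conflict I J \<longleftrightarrow> {fst I..<snd I} \<inter> {fst J..<snd J} \<noteq> {}"

definition interval_length :: "interval \<Rightarrow> real" where
  "interval_length I = snd I - fst I"

text \<open>An instance lists the intervals in order of arrival; the same interval may arrive repeatedly.\<close>

definition is_instance :: "nat \<Rightarrow> interval list \<Rightarrow> bool" where
  "is_instance k xs \<longleftrightarrow>
     (\<forall>I\<in>set xs. fst I < snd I) \<and> card (interval_length ` set xs) \<le> k"

text \<open>Sets of pairs suffice to describe solutions, since identical copies of a (nonempty) interval
  conflict with each other.\<close>

definition opt :: "interval list \<Rightarrow> nat" where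
  "opt xs = Max {card T |T. T \<subseteq> set xs \<and> pairwise (\<lambda>I J. \<not> conflict I J) T}"

text \<open>A memoryless algorithm is given by its acceptance probabilities F I S, where I is the
  arriving interval and S the current solution.\<close>

definition memoryless_alg :: "(interval \<Rightarrow> interval set \<Rightarrow> real) \<Rightarrow> bool" where
  "memoryless_alg F \<longleftrightarrow> (\<forall>I S. 0 \<le> F I S \<and> F I S \<le> 1)"

definition step ::
    "(interval \<Rightarrow> interval set \<Rightarrow> real) \<Rightarrow> interval \<Rightarrow> interval set \<Rightarrow> interval set pmf" where
  "step F I S =
     map_pmf (\<lambda>accept. if accept then insert I {J \<in> S. \<not> conflict I J} else S)
       (bernoulli_pmf (F I S))"

primrec run ::
    "(interval \<Rightarrow> interval set \<Rightarrow> real) \<Rightarrow> interval list \<Rightarrow> interval set \<Rightarrow> interval set pmf" where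
  "run F [] S = return_pmf S"
| "run F (I # xs) S = bind_pmf (step F I S) (run F xs)"

definition final_solution ::
    "(interval \<Rightarrow> interval set \<Rightarrow> real) \<Rightarrow> interval list \<Rightarrow> interval set pmf" where
  "final_solution F xs = run F xs {}"

text \<open>Extended reals are used so that OPT / ALG is infinite when ALG = 0 and OPT > 0.\<close>

definition ratio :: "interval list \<Rightarrow> interval set \<Rightarrow> ereal" where
  "ratio xs S = ereal (real (opt xs)) / ereal (real (card S))"

definition prob_ratio_greater ::
    "(interval \<Rightarrow> interval set \<Rightarrow> real) \<Rightarrow> interval list \<Rightarrow> real \<Rightarrow> real" where
  "prob_ratio_greater F xs r =
     measure_pmf.prob (final_solution F xs) {S. ratio xs S > ereal r}"

text \<open>Strict competitiveness (no additive constant) in expectation against an oblivious adversary.\<close>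

definition competitive ::
    "(interval \<Rightarrow> interval set \<Rightarrow> real) \<Rightarrow> nat \<Rightarrow> real \<Rightarrow> bool" where
  "competitive F k c \<longleftrightarrow>
     (\<forall>xs. is_instance k xs \<longrightarrow>
        real (opt xs) \<le> c * measure_pmf.expectation (final_solution F xs) (\<lambda>S. real (card S)))"

end

theory Submission imports Defs begin

text \<open>Repeated arrivals force the algorithm, up to arbitrarily small error probability, to behave
  like a deterministic one that holds a single interval. With one length, every arrival that is
  taken moves the held interval; either it drifts so far that many disjoint intervals have arrived,
  or it stops strictly between two disjoint arrived ones that leave a gap. Offering much shorter
  intervals inside the part of the held interval in that gap, either many of them are rejected or
  one is taken and the game restarts there. Each of the \<open>k\<close> lengths thus contributes two intervals
  to the optimum while the algorithm holds one.\<close>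

section \<open>Conflicts and runs of a memoryless algorithm\<close>

lemma conflict_iff:
  assumes "fst I < snd I" "fst J < snd J"
  shows "conflict I J \<longleftrightarrow> fst I < snd J \<and> fst J < snd I"
proof
  assume "conflict I J"
  then obtain x where "x \<in> {fst I..<snd I} \<inter> {fst J..<snd J}"
    unfolding conflict_def by blast
  then show "fst I < snd J \<and> fst J < snd I" by auto
next
  assume "fst I < snd J \<and> fst J < snd I"
  then have "max (fst I) (fst J) \<in> {fst I..<snd I} \<inter> {fst J..<snd J}"
    using assms by auto
  then show "conflict I J" unfolding conflict_def by blast
qed

lemma conflict_imp_refl: "conflict I J \<Longrightarrow> conflict J J"
  unfolding conflict_def by auto

lemma run_append: "run F (xs @ ys) S = bind_pmf (run F xs S) (run F ys)"
proof (induction xs arbitrary: S)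
  case (Cons I xs)
  then have "run F (xs @ ys) = (\<lambda>S. bind_pmf (run F xs S) (run F ys))" by blast
  then show ?case by (simp add: bind_assoc_pmf)
qed (simp add: bind_return_pmf)

lemma run_subset: "T \<in> set_pmf (run F xs S) \<Longrightarrow> T \<subseteq> S \<union> set xs"
proof (induction xs arbitrary: S)
  case (Cons I xs)
  then obtain U where U: "U \<in> set_pmf (step F I S)" "T \<in> set_pmf (run F xs U)" by auto
  have "U \<subseteq> insert I S" using U(1) by (auto simp: step_def split: if_splits)
  then show ?case using Cons.IH[OF U(2)] by auto
qed auto

text \<open>Keeps only the outcome \<open>x\<close> of the first stage. With
  \<open>run_append\<close> this multiplies the success probabilities of consecutive phases.\<close>

lemma pmf_bind_ge: "pmf p x * pmf (f x) y \<le> pmf (bind_pmf p f) y"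
proof -
  have "pmf p x * pmf (f x) y = (\<integral>z. indicator {x} z * pmf (f x) y \<partial>measure_pmf p)"
    by (simp add: measure_pmf_single)
  also have "\<dots> \<le> (\<integral>z. pmf (f z) y \<partial>measure_pmf p)"
  proof (rule integral_mono)
    show "integrable (measure_pmf p) (\<lambda>z. indicator {x} z * pmf (f x) y)"
      by (rule measure_pmf.integrable_const_bound[where B=1]) (auto simp: indicator_def pmf_le_1)
    show "integrable (measure_pmf p) (\<lambda>z. pmf (f z) y)"
      by (rule measure_pmf.integrable_const_bound[where B=1]) (auto simp: pmf_le_1)
  qed (auto simp: indicator_def)
  finally show ?thesis by (simp add: pmf_bind)
qed

section \<open>Amplification by repeated arrivals\<close>

lemma run_replicate_held:
  assumes "conflict J J"
  shows "run F (replicate n J) {J} = return_pmf {J}"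
proof (induction n)
  case (Suc n)
  \<comment> \<open>A taken copy of \<open>J\<close> evicts the held one, so both outcomes of the
    coin leave \<open>{J}\<close>.\<close>
  have "step F J {J} = return_pmf {J}"
  proof -
    have "{K \<in> {J}. \<not> conflict J K} = {}" using assms by blast
    then show ?thesis unfolding step_def by (simp only: if_cancel map_pmf_const)
  qed
  then show ?case by (simp add: Suc bind_return_pmf)
qed simp

lemma run_single_rejected:
  assumes "F J S = 0"
  shows "run F [J] S = return_pmf S"
proof -
  have "bernoulli_pmf 0 = return_pmf False"
    by (rule pmf_eqI) (auto simp: indicator_def split: bool.splits)
  then show ?thesis using assms by (simp add: step_def bind_return_pmf bind_return_pmf')
qed

lemma memoryless_algD:
  assumes "memoryless_alg F"
  shows "0 \<le> F I S" "F I S \<le> 1"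
  using assms unfolding memoryless_alg_def by blast+

text \<open>A rejection leaves \<open>S\<close> unchanged, so by memorylessness the next copy meets
  the same probability. The first acceptance leads to \<open>{J}\<close>, which is absorbing, so
  failure needs \<open>n\<close> independent rejections.\<close>

lemma pmf_run_replicate:
  assumes "memoryless_alg F" and clear: "{K \<in> S. \<not> conflict J K} = {}" and "conflict J J"
  shows "1 - (1 - F J S) ^ n \<le> pmf (run F (replicate n J) S) {J}"
proof (induction n)
  case (Suc n)
  let ?q = "F J S"
  have q: "0 \<le> ?q" "?q \<le> 1" using memoryless_algD[OF assms(1)] by blast+
  have "pmf (run F (replicate (Suc n) J) S) {J}
      = ?q * pmf (run F (replicate n J) {J}) {J} + (1 - ?q) * pmf (run F (replicate n J) S) {J}"
    using q unfolding run.simps replicate_Suc step_def clear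
    by (simp add: bind_map_pmf pmf_bind)
  also have "\<dots> = ?q + (1 - ?q) * pmf (run F (replicate n J) S) {J}"
    by (simp add: run_replicate_held[OF assms(3)])
  also have "\<dots> \<ge> ?q + (1 - ?q) * (1 - (1 - ?q) ^ n)"
    using Suc q by (intro add_left_mono mult_left_mono) auto
  finally show ?case by (simp add: algebra_simps)
qed simp

text \<open>Only the set of arrivals is fixed, not the sequence: the numbers of repetitions may grow
  as \<open>q\<close> approaches 1, whereas the optimum and the lengths depend on the set
  alone.\<close>

definition reach ::
    "(interval \<Rightarrow> interval set \<Rightarrow> real) \<Rightarrow> interval set \<Rightarrow> interval \<Rightarrow> bool" where
  "reach F V I \<longleftrightarrow> (\<forall>q<1. \<exists>xs. set xs = V \<and> q \<le> pmf (run F xs {}) {I})"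

lemma replicate_accepts:
  assumes "memoryless_alg F" "{K \<in> S. \<not> conflict J K} = {}" "conflict J J" "F J S > 0" "q < 1"
  obtains n where "n > 0" "q \<le> pmf (run F (replicate n J) S) {J}"
proof -
  have "0 \<le> 1 - F J S" "1 - F J S < 1"
    using memoryless_algD[OF assms(1)] assms(4) by simp_all
  then obtain n where n: "(1 - F J S) ^ n < 1 - q"
    using real_arch_pow_inv[of "1 - q" "1 - F J S"] assms(5) by auto
  \<comment> \<open>One extra copy makes the count positive, so that \<open>J\<close> is indeed
    among the arrivals.\<close>
  moreover have "(1 - F J S) ^ Suc n \<le> (1 - F J S) ^ n"
    using \<open>0 \<le> 1 - F J S\<close> \<open>1 - F J S < 1\<close> by (intro power_decreasing) auto
  ultimately have "q \<le> pmf (run F (replicate (Suc n) J) S) {J}"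
    using pmf_run_replicate[OF assms(1-3), of "Suc n"] by linarith
  then show ?thesis using that[of "Suc n"] by blast
qed

lemma reach_start:
  assumes "memoryless_alg F" "conflict I I" "F I {} > 0"
  shows "reach F {I} I"
  unfolding reach_def
proof (intro allI impI)
  fix q :: real assume "q < 1"
  obtain n where "n > 0" "q \<le> pmf (run F (replicate n I) {}) {I}"
    using replicate_accepts[of F "{}" I q] assms \<open>q < 1\<close> by auto
  then show "\<exists>xs. set xs = {I} \<and> q \<le> pmf (run F xs {}) {I}"
    by (intro exI[of _ "replicate n I"]) auto
qed

text \<open>Repeating an arrival makes a memoryless algorithm essentially deterministic: any positive
  acceptance probability is amplified to one.\<close>

lemma reach_step:
  assumes F: "memoryless_alg F" and R: "reach F V I" and IJ: "conflict I J"
  shows "reach F (insert J V) I \<or> reach F (insert J V) J"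
proof (cases "F J {I} = 0")
  case True
  have "reach F (insert J V) I"
    unfolding reach_def
  proof (intro allI impI)
    fix q :: real assume "q < 1"
    then obtain xs where xs: "set xs = V" "q \<le> pmf (run F xs {}) {I}"
      using R unfolding reach_def by blast
    have "pmf (run F xs {}) {I} * pmf (run F [J] {I}) {I} \<le> pmf (run F (xs @ [J]) {}) {I}"
      unfolding run_append by (rule pmf_bind_ge)
    then show "\<exists>xs. set xs = insert J V \<and> q \<le> pmf (run F xs {}) {I}"
      using xs by (intro exI[of _ "xs @ [J]"]) (simp add: run_single_rejected[of F, OF True] del: run.simps)
  qed
  then show ?thesis ..
next
  case False
  then have pos: "F J {I} > 0" using memoryless_algD[OF F] by (simp add: less_le)
  have JI: "{K \<in> {I}. \<not> conflict J K} = {}" using IJ by (auto simp: conflict_def)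
  have "reach F (insert J V) J"
    unfolding reach_def
  proof (intro allI impI)
    fix q :: real assume "q < 1"
    \<comment> \<open>The target is split into two factors below 1, one for each phase. The maximum
      with 0 handles negative \<open>q\<close>.\<close>
    define s where "s = (1 + max q 0) / 2"
    define t where "t = max q 0 / s"
    have s: "0 < s" "s < 1" "t < 1" "0 \<le> t" "t * s = max q 0"
      using \<open>q < 1\<close> by (auto simp: s_def t_def field_simps)
    obtain xs where xs: "set xs = V" "s \<le> pmf (run F xs {}) {I}"
      using R s unfolding reach_def by blast
    obtain n where n: "n > 0" "t \<le> pmf (run F (replicate n J) {I}) {J}"
      using replicate_accepts[OF F JI conflict_imp_refl[OF IJ] pos s(3)] by auto
    have "q \<le> s * t" using s by (simp add: mult.commute)
    also have "\<dots> \<le> pmf (run F xs {}) {I} * pmf (run F (replicate n J) {I}) {J}"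
      using xs n s by (intro mult_mono) auto
    also have "\<dots> \<le> pmf (run F (xs @ replicate n J) {}) {J}"
      unfolding run_append by (rule pmf_bind_ge)
    finally show "\<exists>xs. set xs = insert J V \<and> q \<le> pmf (run F xs {}) {J}"
      using xs n by (intro exI[of _ "xs @ replicate n J"]) auto
  qed
  then show ?thesis ..
qed

text \<open>In the next two lemmas \<open>R P x\<close> says that the unit intervals starting at the points of \<open>P\<close>
  have arrived and that the one starting at \<open>x\<close> is held. A held interval lying strictly between two
  separated arrived ones is the goal; an extreme held interval that avoids this has to keep
  moving outwards.\<close>

definition flanked :: "real set \<Rightarrow> real \<Rightarrow> bool" where
  "flanked P x \<longleftrightarrow> (\<exists>l\<in>P. \<exists>r\<in>P. l < x \<and> x < r \<and> r - l > 1)"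

text \<open>The sign \<sigma> treats both directions of drift at once; for \<sigma> = -1 the points
  \<open>l\<close> and \<open>r\<close> swap sides.\<close>

lemma flankedI:
  assumes "\<sigma> = 1 \<or> \<sigma> = -1" "l \<in> P" "r \<in> P" "\<sigma> * l < \<sigma> * x" "\<sigma> * x < \<sigma> * r" "\<sigma> * (r - l) > 1"
  shows "flanked P x"
  using assms unfolding flanked_def by force

text \<open>The point \<open>l\<close> stays more than 1 behind the held one. Each round makes an
  offer behind and then one ahead; unless one of them produces a flanked point, the held point
  advances by 3/5. This is below 1, so that successive intervals conflict, and above 1/2, so that
  every second one is disjoint.\<close>

lemma flanked_or_escape:
  fixes R :: "real set \<Rightarrow> real \<Rightarrow> bool" and \<sigma> :: real and n :: nat
  assumes step: "\<And>P x y. R P x \<Longrightarrow> \<bar>y - x\<bar> < 1 \<Longrightarrow> R (insert y P) x \<or> R (insert y P) y"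
    and \<sigma>: "\<sigma> = 1 \<or> \<sigma> = -1"
    and init: "R P x" "x \<in> P" "l \<in> P" "\<sigma> * (x - l) > 1" "P \<subseteq> {-b..b}"
  shows "\<exists>P' y. R P' y \<and> P' \<subseteq> {-(b + 3/5 * n)..b + 3/5 * n} \<and>
    (flanked P' y \<or> y = x + \<sigma> * (3/5 * n) \<and> l \<in> P' \<and> (\<forall>i\<le>n. x + \<sigma> * (3/5 * real i) \<in> P'))"
proof (induction n)
  case 0
  then show ?case using init by (intro exI[of _ P] exI[of _ x]) auto
next
  case (Suc n)
  then obtain P' y where P': "R P' y" "P' \<subseteq> {-(b + 3/5 * n)..b + 3/5 * n}"
    and disj: "flanked P' y \<or> y = x + \<sigma> * (3/5 * n) \<and> l \<in> P' \<and> (\<forall>i\<le>n. x + \<sigma> * (3/5 * real i) \<in> P')"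
    by blast
  have mono: "{-(b + 3/5 * real n)..b + 3/5 * n} \<subseteq> {-(b + 3/5 * Suc n)..b + 3/5 * Suc n}" by auto
  show ?case
  proof (cases "flanked P' y")
    case True
    then show ?thesis using P' mono by blast
  next
    case False
    then have y: "y = x + \<sigma> * (3/5 * n)" and lP: "l \<in> P'"
      and all: "\<forall>i\<le>n. x + \<sigma> * (3/5 * real i) \<in> P'" using disj by auto
    have yP: "y \<in> P'" using all y by auto
    have far: "\<sigma> * (y - l) > 1" using init(4) y \<sigma> by auto
    \<comment> \<open>If \<open>z\<close> is taken, it lies between \<open>l\<close> and
      \<open>y\<close>, which are more than 1 apart. If \<open>w\<close> is rejected,
      \<open>y\<close> lies between \<open>l\<close> and \<open>w\<close>.\<close>
    define z where "z = y - \<sigma> / 2"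
    define w where "w = y + \<sigma> * (3/5)"
    have zb: "insert z P' \<subseteq> {-(b + 3/5 * Suc n)..b + 3/5 * Suc n}"
      and wb: "insert w (insert z P') \<subseteq> {-(b + 3/5 * Suc n)..b + 3/5 * Suc n}"
    proof -
      have \<sigma>b: "-1 \<le> \<sigma>" "\<sigma> \<le> 1" using \<sigma> by auto
      have "-(b + 3/5 * n) \<le> y" "y \<le> b + 3/5 * n" using P'(2) yP by auto
      then have "z \<in> {-(b + 3/5 * Suc n)..b + 3/5 * Suc n}"
        and "w \<in> {-(b + 3/5 * Suc n)..b + 3/5 * Suc n}"
        using \<sigma>b unfolding z_def w_def atLeastAtMost_iff of_nat_Suc
        by (simp_all add: field_simps)
      then show "insert z P' \<subseteq> {-(b + 3/5 * Suc n)..b + 3/5 * Suc n}"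
        "insert w (insert z P') \<subseteq> {-(b + 3/5 * Suc n)..b + 3/5 * Suc n}"
        using P'(2) mono by blast+
    qed
    have "R (insert z P') y \<or> R (insert z P') z"
      using step[OF P'(1), of z] \<sigma> by (auto simp: z_def)
    then show ?thesis
    proof
      assume "R (insert z P') z"
      moreover have "flanked (insert z P') z"
        using \<sigma> lP yP far by (intro flankedI[where \<sigma>=\<sigma> and l=l and r=y]) (auto simp: z_def)
      ultimately show ?thesis using zb by blast
    next
      assume "R (insert z P') y"
      then have "R (insert w (insert z P')) y \<or> R (insert w (insert z P')) w"
        by (rule step) (use \<sigma> in \<open>auto simp: w_def\<close>)
      then show ?thesis
      proof
        assume "R (insert w (insert z P')) y"
        moreover have "flanked (insert w (insert z P')) y"
          using \<sigma> lP yP far by (intro flankedI[where \<sigma>=\<sigma> and l=l and r=w]) (auto simp: w_def)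
        ultimately show ?thesis using wb by blast
      next
        assume "R (insert w (insert z P')) w"
        moreover have "w = x + \<sigma> * (3/5 * Suc n)" by (simp add: w_def y algebra_simps)
        moreover have "\<forall>i\<le>Suc n. x + \<sigma> * (3/5 * real i) \<in> insert w (insert z P')"
          using all calculation(2) by (auto simp: le_Suc_eq)
        ultimately show ?thesis using wb lP by blast
      qed
    qed
  qed
qed

lemma flanked_or_many:
  fixes R :: "real set \<Rightarrow> real \<Rightarrow> bool"
  assumes step: "\<And>P x y. R P x \<Longrightarrow> \<bar>y - x\<bar> < 1 \<Longrightarrow> R (insert y P) x \<or> R (insert y P) y"
    and init: "R {0} 0"
  shows "\<exists>P x. R P x \<and> P \<subseteq> {-(2 + 6/5 * n)..2 + 6/5 * n} \<and>
    (flanked P x \<or> (\<exists>Q\<subseteq>P. card Q = n \<and> pairwise (\<lambda>x y. \<bar>x - y\<bar> \<ge> 1) Q))"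
proof -
  have big: "{-2..2} \<subseteq> {-(2 + 6/5 * real n)..2 + 6/5 * real n}" by auto
  have "R {1/2, 0} 0 \<or> R {1/2, 0} (1/2)" using step[OF init, of "1/2"] by simp
  then obtain z \<sigma> where z: "R {1/2, 0} z" "z = 0 \<and> \<sigma> = -1 \<or> z = 1/2 \<and> \<sigma> = (1::real)" by blast
  \<comment> \<open>Here \<open>l\<close> is whichever of 0 and 1/2 is not held, and \<sigma> points
    from it to \<open>z\<close>. As 1/2 + 9/10 > 1, rejecting \<open>x\<close> leaves
    \<open>z\<close> flanked, and taking it starts the drift with \<open>l\<close> far enough
    behind.\<close>
  define x where "x = z + \<sigma> * (9/10)"
  define l where "l = z - \<sigma> / 2"
  define P where "P = {x, 1/2, 0}"
  have \<sigma>: "\<sigma> = 1 \<or> \<sigma> = -1" using z by auto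
  have PB: "P \<subseteq> {-2..2}" "x \<in> P" "l \<in> P" using z(2) by (auto simp: P_def x_def l_def)
  have "R P z \<or> R P x" unfolding P_def
    using step[OF z(1), of x] \<sigma> by (auto simp: x_def)
  then show ?thesis
  proof
    assume "R P z"
    moreover have "flanked P z"
      using \<sigma> PB by (intro flankedI[where \<sigma>=\<sigma> and l=l and r=x]) (auto simp: x_def l_def)
    ultimately show ?thesis using PB big by blast
  next
    assume Rx: "R P x"
    have "\<sigma> * (x - l) > 1" using \<sigma> by (auto simp: x_def l_def)
    from flanked_or_escape[of R, OF step \<sigma> Rx PB(2,3) this PB(1), of "2 * n"]
    obtain P' y where P': "R P' y" "P' \<subseteq> {-(2 + 3/5 * real (2 * n))..2 + 3/5 * real (2 * n)}"
      and disj: "flanked P' y \<or> (\<forall>i\<le>2*n. x + \<sigma> * (3/5 * real i) \<in> P')" by blast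
    have P'B: "P' \<subseteq> {-(2 + 6/5 * real n)..2 + 6/5 * real n}" using P'(2) by simp
    show ?thesis
    proof (cases "flanked P' y")
      case True
      then show ?thesis using P' P'B by blast
    next
      case False
      \<comment> \<open>Of the positions visited in \<open>2 * n\<close> rounds every second one is
        used, which makes the spacing 6/5.\<close>
      define g where "g = (\<lambda>i::nat. x + \<sigma> * (6/5 * real i))"
      have "g i \<in> P'" if "i < n" for i
        using False disj that by (auto simp: g_def dest!: spec[of _ "2 * i"])
      then have "g ` {..<n} \<subseteq> P'" by auto
      moreover have "inj_on g {..<n}" using \<sigma> by (auto simp: inj_on_def g_def)
      then have "card (g ` {..<n}) = n" by (simp add: card_image)
      moreover have "pairwise (\<lambda>x y. \<bar>x - y\<bar> \<ge> 1) (g ` {..<n})"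
      proof (rule pairwise_imageI)
        fix i j :: nat assume "i \<noteq> j"
        then have "\<bar>real i - real j\<bar> \<ge> 1" by linarith
        then show "\<bar>g i - g j\<bar> \<ge> 1" using \<sigma> by (auto simp: g_def)
      qed
      ultimately show ?thesis using P' P'B by blast
    qed
  qed
qed


section \<open>Induction on the number of lengths\<close>

definition separated :: "interval set \<Rightarrow> bool" where
  "separated T \<longleftrightarrow> pairwise (\<lambda>I J. \<not> conflict I J) T"

text \<open>The adversary's goal: one interval held with probability arbitrarily close to 1, against
  an optimum of at least \<open>2 * k\<close>.\<close>

definition forced_win :: "(interval \<Rightarrow> interval set \<Rightarrow> real) \<Rightarrow> nat \<Rightarrow> bool" where
  "forced_win F k \<longleftrightarrow> (\<exists>V I T. reach F V I \<and> (\<forall>K\<in>V. fst K < snd K) \<and>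
     card (interval_length ` V) \<le> k \<and> T \<subseteq> V \<and> separated T \<and> 2 * k \<le> card T)"

text \<open>The induction invariant. Later intervals are placed inside the window from
  \<open>u\<close> to \<open>v\<close>, where they conflict with the held interval but not with the
  \<open>2 * j\<close> intervals saved in \<open>T\<close>.\<close>

definition forced_level :: "(interval \<Rightarrow> interval set \<Rightarrow> real) \<Rightarrow> nat \<Rightarrow> bool" where
  "forced_level F j \<longleftrightarrow> (\<exists>V I T u v. reach F V I \<and> (\<forall>K\<in>V. fst K < snd K) \<and>
     card (interval_length ` V) \<le> j \<and> T \<subseteq> V \<and> separated T \<and> card T = 2 * j \<and>
     u < v \<and> fst I \<le> u \<and> v \<le> snd I \<and> (\<forall>K\<in>T. snd K \<le> u \<or> v \<le> fst K))"

lemma reach_finite: "reach F V I \<Longrightarrow> finite V"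
  unfolding reach_def by (metis List.finite_set zero_less_one)

lemma forced_level_imp_win: "forced_level F k \<Longrightarrow> forced_win F k"
  unfolding forced_level_def forced_win_def by (metis order_refl)

lemma separated_insert:
  assumes "separated T" "fst I < snd I" "\<forall>K\<in>T. fst K < snd K"
    and "\<forall>K\<in>T. snd K \<le> fst I \<or> snd I \<le> fst K"
  shows "separated (insert I T)" "I \<notin> T"
proof -
  have "\<not> conflict I K \<and> \<not> conflict K I" if "K \<in> T" for K
    using assms that by (force simp: conflict_iff)
  then show "separated (insert I T)"
    using assms(1) unfolding separated_def pairwise_insert by blast
  show "I \<notin> T" using assms(2,4) by force
qed

text \<open>The map \<open>f\<close> scales the one-length game by \<open>d\<close> and moves it to
  \<open>a\<close>. A long drift yields \<open>2 * k\<close> disjoint intervals and wins; otherwise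
  the two flanking intervals join \<open>T\<close>. The margin \<open>far\<close> keeps the whole
  game clear of \<open>T\<close>.\<close>

lemma forced_level_Suc_of_held:
  fixes a d :: real
  assumes F: "memoryless_alg F" and k: "Suc j \<le> k" and d: "d > 0"
    and held: "reach F (insert (a, a + d) V) (a, a + d)"
    and V: "\<forall>K\<in>V. fst K < snd K" "finite V" "card (insert d (interval_length ` V)) \<le> Suc j"
    and T: "T \<subseteq> V" "separated T" "card T = 2 * j"
    and far: "\<forall>K\<in>T. snd K \<le> a - d * (6 * k) \<or> a + d * (6 * k) \<le> fst K"
  shows "forced_win F k \<or> forced_level F (Suc j)"
proof -
  define f where "f x = (a + d * x, a + d * x + d)" for x :: real
  define R where "R P x \<longleftrightarrow> reach F (V \<union> f ` P) (f x)" for P x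
  have fne: "fst (f x) < snd (f x)" for x using d by (simp add: f_def)
  have conf: "conflict (f x) (f y) \<longleftrightarrow> \<bar>y - x\<bar> < 1" for x y
  proof -
    have "conflict (f x) (f y) \<longleftrightarrow> d * x < d * (y + 1) \<and> d * y < d * (x + 1)"
      unfolding conflict_iff[OF fne fne] by (auto simp: f_def algebra_simps)
    also have "\<dots> \<longleftrightarrow> x < y + 1 \<and> y < x + 1" using d by simp
    finally show ?thesis by auto
  qed
  have step: "R (insert y P) x \<or> R (insert y P) y" if "R P x" "\<bar>y - x\<bar> < 1" for P x y
    using reach_step[OF F, of "V \<union> f ` P" "f x" "f y"] that conf by (simp add: R_def)
  have "R {0} 0" using held by (simp add: R_def f_def)
  from flanked_or_many[of R, OF step this, of "2 * k"]
  obtain P x where P: "R P x" "P \<subseteq> {-(2 + 6/5 * real (2 * k))..2 + 6/5 * real (2 * k)}"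
    and disj: "flanked P x \<or> (\<exists>Q\<subseteq>P. card Q = 2 * k \<and> pairwise (\<lambda>x y. \<bar>x - y\<bar> \<ge> 1) Q)"
    by blast
  let ?V = "V \<union> f ` P"
  have Vne: "\<forall>K\<in>?V. fst K < snd K" using V(1) fne by auto
  have "interval_length ` ?V \<subseteq> insert d (interval_length ` V)"
    by (auto simp: interval_length_def f_def)
  then have card: "card (interval_length ` ?V) \<le> Suc j"
    using V(2,3) by (meson card_mono finite.insertI finite_imageI le_trans)
  have reach: "reach F ?V (f x)" using P(1) by (simp add: R_def)
  show ?thesis
  proof (cases "flanked P x")
    case False
    then obtain Q where Q: "Q \<subseteq> P" "card Q = 2 * k" "pairwise (\<lambda>x y. \<bar>x - y\<bar> \<ge> 1) Q"
      using disj by blast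
    have "inj_on f Q" using d by (auto simp: inj_on_def f_def)
    then have "card (f ` Q) = 2 * k" using Q(2) by (simp add: card_image)
    moreover have "separated (f ` Q)"
      unfolding separated_def
      by (rule pairwise_imageI) (use Q(3) in \<open>fastforce simp: conf pairwise_def\<close>)
    ultimately show ?thesis
      using reach Vne card k Q(1) unfolding forced_win_def
      by (intro disjI1 exI[of _ ?V] exI[of _ "f x"] exI[of _ "f ` Q"]) auto
  next
    case True
    then obtain l r where lr: "l \<in> P" "r \<in> P" "l < x" "x < r" "r - l > 1"
      unfolding flanked_def by blast
    \<comment> \<open>Starting points have modulus at most 2 + 12k/5, and adding the unit length
      gives 3 + 12k/5, which is at most 6k for k at least 1.\<close>
    have near: "a - d * (6 * k) \<le> fst (f y)" "snd (f y) \<le> a + d * (6 * k)" if "y \<in> P" for y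
    proof -
      have "real k \<ge> 1" using k by simp
      then have "- (6 * real k) \<le> y" "y + 1 \<le> 6 * real k" using P(2) that by auto
      then have "d * (- (6 * real k)) \<le> d * y" "d * (y + 1) \<le> d * (6 * real k)"
        using d by (intro mult_left_mono; simp)+
      then show "a - d * (6 * k) \<le> fst (f y)" "snd (f y) \<le> a + d * (6 * k)"
        by (simp_all add: f_def algebra_simps)
    qed
    define T' where "T' = insert (f l) (insert (f r) T)"
    \<comment> \<open>The new window is the part of the held interval between the two flanking ones;
      it is nonempty because \<open>l < x < r\<close> and \<open>r - l > 1\<close>.\<close>
    define u where "u = a + d * max x (l + 1)"
    define v where "v = a + d * min (x + 1) r"
    have uv: "u < v" "fst (f x) \<le> u" "v \<le> snd (f x)" "snd (f l) \<le> u" "v \<le> fst (f r)"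
    proof -
      have "max x (l + 1) < min (x + 1) r" using lr by auto
      then show "u < v" using d by (simp add: u_def v_def)
      have "d * x \<le> d * max x (l + 1)" "d * min (x + 1) r \<le> d * (x + 1)"
        "d * (l + 1) \<le> d * max x (l + 1)" "d * min (x + 1) r \<le> d * r"
        using d by (intro mult_left_mono; simp)+
      then show "fst (f x) \<le> u" "v \<le> snd (f x)" "snd (f l) \<le> u" "v \<le> fst (f r)"
        by (simp_all add: u_def v_def f_def algebra_simps)
    qed
    have P_x: "a - d * (6 * k) \<le> u" "v \<le> a + d * (6 * k)"
      using near[OF lr(1)] near[OF lr(2)] uv fne[of l] fne[of r] by linarith+
    have Tne: "\<forall>K\<in>T. fst K < snd K" using T(1) V(1) by auto
    have off: "snd K \<le> fst (f y) \<or> snd (f y) \<le> fst K" if "K \<in> T" "y \<in> P" for K y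
      using far that near[OF that(2)] by fastforce
    have sep_r: "separated (insert (f r) T)" "f r \<notin> T"
      using separated_insert[OF T(2) fne Tne, of r] off lr by auto
    have sep: "separated T'" "f l \<notin> insert (f r) T"
      unfolding T'_def
      using separated_insert[OF sep_r(1) fne, of l] off lr Tne fne uv by auto
    have "finite T" using T(1) V(2) finite_subset by blast
    then have "card T' = 2 * Suc j"
      using sep(2) sep_r(2) T(3) by (simp add: T'_def)
    moreover have "\<forall>K\<in>T'. snd K \<le> u \<or> v \<le> fst K"
    proof
      fix K assume "K \<in> T'"
      then consider "K = f l" | "K = f r" | "K \<in> T" by (auto simp: T'_def)
      then show "snd K \<le> u \<or> v \<le> fst K"
      proof cases
        case 3
        then show ?thesis using far P_x by (meson order_trans)
      qed (use uv in auto)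
    qed
    moreover have "T' \<subseteq> ?V" using T(1) lr by (auto simp: T'_def)
    ultimately have "forced_level F (Suc j)"
      using reach Vne card sep(1) uv unfolding forced_level_def
      by (intro exI[of _ ?V] exI[of _ "f x"] exI[of _ T'] exI[of _ u] exI[of _ v]) auto
    then show ?thesis ..
  qed
qed

text \<open>The offers stop at the first \<open>J i\<close> that takes over. Until then
  \<open>I\<close> is still held, so conflicts with \<open>I\<close> suffice to apply
  \<open>reach_step\<close>.\<close>

lemma reach_or_all_rejected:
  fixes n :: nat
  assumes F: "memoryless_alg F" and "reach F V I" and "\<forall>i<n. conflict I (J i)"
  shows "(\<exists>i<n. reach F (V \<union> J ` {..i}) (J i)) \<or> reach F (V \<union> J ` {..<n}) I"
  using assms(3)
proof (induction n)
  case 0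
  then show ?case using assms(2) by simp
next
  case (Suc n)
  have "insert (J n) (V \<union> J ` {..<n}) = V \<union> J ` {..n}"
    by (simp add: lessThan_Suc_atMost[symmetric] lessThan_Suc)
  then show ?case
    using Suc reach_step[OF F, of "V \<union> J ` {..<n}" I "J n"]
    by (auto simp: lessThan_Suc_atMost less_Suc_eq)
qed

lemma forced_level_Suc:
  assumes F: "memoryless_alg F" and k: "Suc j \<le> k" and "forced_level F j"
  shows "forced_win F k \<or> forced_level F (Suc j)"
proof -
  obtain V I T u v where reach: "reach F V I" and V: "\<forall>K\<in>V. fst K < snd K"
    "card (interval_length ` V) \<le> j" and T: "T \<subseteq> V" "separated T" "card T = 2 * j"
    and uv: "u < v" "fst I \<le> u" "v \<le> snd I" and out: "\<forall>K\<in>T. snd K \<le> u \<or> v \<le> fst K"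
    using assms(3) unfolding forced_level_def by blast
  have k1: "real k \<ge> 1" using k by simp
  \<comment> \<open>The window is cut into 14k pieces: \<open>2 * k\<close> adjacent offers in the
    middle, with a margin of 6k pieces on either side for the game that restarts at whichever offer
    is taken.\<close>
  define d where "d = (v - u) / (14 * k)"
  have d: "d > 0" using uv k1 by (simp add: d_def)
  have v: "v = u + d * (14 * k)" using k1 by (simp add: d_def)
  define c where "c i = u + d * (6 * k) + d * real i" for i :: nat
  define J where "J i = (c i, c i + d)" for i
  have inside: "u \<le> c i - d * (6 * k)" "c i + d * (6 * k) \<le> v" if "i < 2 * k" for i
  proof -
    have "0 \<le> d * real i" "d * real i \<le> d * (2 * real k)"
      using that d by (auto intro!: mult_left_mono simp: of_nat_mult[symmetric] simp del: of_nat_mult)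
    then show "u \<le> c i - d * (6 * k)" "c i + d * (6 * k) \<le> v"
      by (simp_all add: c_def v algebra_simps)
  qed
  have dk: "d \<le> d * (6 * k)" using d k1 by simp
  have Jne: "fst (J i) < snd (J i)" for i using d by (simp add: J_def)
  have conf: "conflict I (J i)" if "i < 2 * k" for i
  proof -
    have "fst I < snd I" "fst I < c i + d" "c i < snd I"
      using uv inside[OF that] d dk by linarith+
    then show ?thesis by (subst conflict_iff[OF _ Jne]) (auto simp: J_def)
  qed
  have lens: "insert d (interval_length ` (V \<union> J ` A)) = insert d (interval_length ` V)" for A
    by (auto simp: J_def interval_length_def)
  have fin: "finite V" using reach by (rule reach_finite)
  then have cardd: "card (insert d (interval_length ` V)) \<le> Suc j"
    using V(2) card_insert_le_m1[of "Suc j"] by (simp add: card_insert_if)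
  have "(\<exists>i<2*k. reach F (V \<union> J ` {..i}) (J i)) \<or> reach F (V \<union> J ` {..<2*k}) I"
    using reach_or_all_rejected[OF F reach] conf by blast
  then show ?thesis
  proof
    assume "\<exists>i<2*k. reach F (V \<union> J ` {..i}) (J i)"
    then obtain i where i: "i < 2 * k" "reach F (V \<union> J ` {..i}) (J i)" by blast
    have eq: "insert (c i, c i + d) (V \<union> J ` {..i}) = V \<union> J ` {..i}"
      by (auto simp: J_def)
    show ?thesis
    proof (rule forced_level_Suc_of_held[OF F k d, where V="V \<union> J ` {..i}" and a="c i" and T=T])
      show "reach F (insert (c i, c i + d) (V \<union> J ` {..i})) (c i, c i + d)"
        unfolding eq using i(2) by (simp add: J_def)
      show "\<forall>K\<in>V \<union> J ` {..i}. fst K < snd K" using V(1) Jne by auto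
      show "\<forall>K\<in>T. snd K \<le> c i - d * (6 * k) \<or> c i + d * (6 * k) \<le> fst K"
        using out inside[OF i(1)] by fastforce
    qed (use fin cardd T in \<open>auto simp: lens\<close>)
  next
    \<comment> \<open>All offers were rejected, and being adjacent they are disjoint: an immediate
      win.\<close>
    assume R: "reach F (V \<union> J ` {..<2*k}) I"
    have notconf: "\<not> conflict (J i) (J m)" if "i \<noteq> m" for i m
    proof -
      have "1 \<le> \<bar>real i - real m\<bar>" using that by linarith
      then have "d * 1 \<le> d * \<bar>real i - real m\<bar>" using d by (intro mult_left_mono) auto
      also have "\<dots> = \<bar>c i - c m\<bar>" using d by (simp add: c_def abs_mult right_diff_distrib[symmetric])
      finally show ?thesis unfolding conflict_iff[OF Jne Jne] by (auto simp: J_def)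
    qed
    have "inj_on J {..<2*k}" using d by (auto simp: inj_on_def J_def c_def)
    then have "card (J ` {..<2*k}) = 2 * k" by (simp add: card_image)
    moreover have "separated (J ` {..<2*k})"
      unfolding separated_def by (rule pairwise_imageI) (use notconf in blast)
    moreover have "card (interval_length ` (V \<union> J ` {..<2*k})) \<le> k"
    proof -
      have "card (interval_length ` (V \<union> J ` {..<2*k}))
          \<le> card (insert d (interval_length ` (V \<union> J ` {..<2*k})))"
        using fin by (intro card_mono) auto
      then show ?thesis using cardd k unfolding lens by linarith
    qed
    ultimately have "forced_win F k"
      using R V(1) Jne unfolding forced_win_def
      by (intro exI[of _ "V \<union> J ` {..<2*k}"] exI[of _ I] exI[of _ "J ` {..<2*k}"]) auto
    then show ?thesis ..
  qed
qed

text \<open>The induction starts at level 1, obtained by playing the one-length game from the held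
  interval \<open>(0, 1)\<close> with nothing saved. Level \<open>k\<close> is itself a win.\<close>

lemma forced_win:
  assumes F: "memoryless_alg F" and k: "k \<ge> 1" and "F (0, 1) {} > 0"
  shows "forced_win F k"
proof -
  have "forced_win F k \<or> forced_level F j" if "1 \<le> j" "j \<le> k" for j
    using that
  proof (induction j rule: dec_induct)
    case base
    have "conflict (0, 1) (0, 1)" by (simp add: conflict_iff)
    then have "reach F {(0, 1)} (0, 1)" using reach_start F assms(3) by blast
    then show ?case
      using forced_level_Suc_of_held[OF F, of 0 k 1 0 "{}" "{}"] k
      by (simp add: separated_def)
  next
    case (step j)
    then show ?case using forced_level_Suc[OF F, of j k] by auto
  qed
  then show ?thesis using k forced_level_imp_win by blast
qed

section \<open>From a forced win to the competitive ratio\<close>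

lemma opt_ge:
  assumes "T \<subseteq> set xs" "separated T"
  shows "card T \<le> opt xs"
proof -
  have "finite {card T |T. T \<subseteq> set xs \<and> pairwise (\<lambda>I J. \<not> conflict I J) T}"
    by (rule finite_subset[of _ "card ` Pow (set xs)"]) auto
  then show ?thesis using assms unfolding opt_def separated_def by (intro Max_ge) auto
qed

text \<open>The solution has size 1 if it is \<open>{I}\<close>, and otherwise at most the number of
  distinct arrivals.\<close>

lemma expectation_card_le:
  "measure_pmf.expectation (run F xs {}) (\<lambda>S. real (card S))
    \<le> 1 + real (card (set xs)) * (1 - pmf (run F xs {}) {I})"
proof -
  let ?p = "run F xs {}" and ?M = "real (card (set xs))"
  have sub: "S \<subseteq> set xs" if "S \<in> set_pmf ?p" for S
    using run_subset[OF that] by simp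
  then have "finite (set_pmf ?p)" by (meson List.finite_set Pow_iff finite_Pow_iff finite_subset subsetI)
  then have int: "integrable ?p g" for g :: "interval set \<Rightarrow> real"
    by (rule integrable_measure_pmf_finite)
  have "card S \<le> 1 + ?M * (1 - indicator {{I}} S)" if "S \<in> set_pmf ?p" for S
    using card_mono[OF _ sub[OF that]] by (auto simp: indicator_def)
  then have "measure_pmf.expectation ?p (\<lambda>S. real (card S))
      \<le> measure_pmf.expectation ?p (\<lambda>S. 1 + ?M * (1 - indicator {{I}} S))"
    by (intro integral_mono_AE int) (auto simp: AE_measure_pmf_iff)
  also have "\<dots> = 1 + ?M * (1 - pmf ?p {I})"
    by (simp add: int measure_pmf_single)
  finally show ?thesis .
qed

text \<open>In the second conjunct \<epsilon> is chosen after \<open>p\<close>; the third lets it be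
  arbitrarily small for every \<open>p\<close> below 1.\<close>

theorem theorem3:
  fixes k :: nat and F :: "interval \<Rightarrow> interval set \<Rightarrow> real"
  assumes "k \<ge> 1" and "memoryless_alg F"
  shows "(\<forall>c. c < 2 * real k \<longrightarrow> \<not> competitive F k c)
    \<and> (\<forall>p. 0 < p \<and> p \<le> 1 \<longrightarrow>
          (\<exists>\<epsilon>>0. \<exists>xs. is_instance k xs \<and> prob_ratio_greater F xs (2 * real k - \<epsilon>) \<ge> p))
    \<and> (\<forall>p \<epsilon>. 0 < p \<and> p < 1 \<and> 0 < \<epsilon> \<longrightarrow>
          (\<exists>xs. is_instance k xs \<and> prob_ratio_greater F xs (2 * real k - \<epsilon>) \<ge> p))"
proof (intro conjI)
  let ?I = "(0, 1) :: interval"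
  have inst1: "is_instance k [?I]" using assms(1) by (simp add: is_instance_def)
  have opt1: "opt [?I] \<ge> 1"
    using opt_ge[of "{?I}" "[?I]"] by (simp add: separated_def)
  have zero: "final_solution F [?I] = return_pmf {}" if "F ?I {} = 0"
    unfolding final_solution_def using that by (rule run_single_rejected)
  have win: "\<exists>V I T. reach F V I \<and> (\<forall>K\<in>V. fst K < snd K) \<and>
     card (interval_length ` V) \<le> k \<and> T \<subseteq> V \<and> separated T \<and> 2 * k \<le> card T"
    if "F ?I {} \<noteq> 0"
  proof -
    have "F ?I {} > 0"
      using memoryless_algD[OF assms(2)] that by (simp add: less_le)
    then show ?thesis using forced_win[OF assms(2,1)] unfolding forced_win_def by blast
  qed
  show "\<forall>c. c < 2 * real k \<longrightarrow> \<not> competitive F k c"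
  proof (intro allI impI notI)
    fix c assume c: "c < 2 * real k" and comp: "competitive F k c"
    have bound: "real (opt xs) \<le> c * measure_pmf.expectation (run F xs {}) (\<lambda>S. real (card S))"
      if "is_instance k xs" for xs
      using comp that unfolding competitive_def final_solution_def by blast
    show False
    \<comment> \<open>An algorithm that never takes \<open>(0, 1)\<close> from the empty state ends
      with nothing on that single arrival; any other one can be forced.\<close>
    proof (cases "F ?I {} = 0")
      case True
      then show False using bound[OF inst1] zero opt1 by (simp add: final_solution_def)
    next
      case False
      then obtain V I T where V: "reach F V I" "\<forall>K\<in>V. fst K < snd K"
        "card (interval_length ` V) \<le> k" and T: "T \<subseteq> V" "separated T" "2 * k \<le> card T"
        using win by blast
      define M where "M = real (card V)"
      \<comment> \<open>Replacing \<open>c\<close> by a positive constant still below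
        \<open>2 * k\<close> allows multiplying the bound on the expectation. Then \<open>e\<close>
        makes the error term half of the gap; \<open>M\<close> depends on \<open>V\<close> alone, so
        \<open>e\<close> can be fixed before the sequence.\<close>
      define C where "C = max c 1"
      define e where "e = (2 * real k - C) / (2 * C * (M + 1))"
      have pos: "C > 0" "C < 2 * real k" "M \<ge> 0" using c assms(1) by (auto simp: M_def C_def)
      then have e: "e > 0" by (simp add: e_def)
      obtain xs where xs: "set xs = V" "1 - e \<le> pmf (run F xs {}) {I}"
        using V(1) e unfolding reach_def by (meson diff_less_eq less_add_same_cancel1)
      let ?E = "measure_pmf.expectation (run F xs {}) (\<lambda>S. real (card S))"
      have inst: "is_instance k xs" using V xs by (simp add: is_instance_def)
      have "?E \<le> 1 + M * (1 - pmf (run F xs {}) {I})"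
        using expectation_card_le[of F xs I] xs by (simp add: M_def)
      also have "\<dots> \<le> 1 + (M + 1) * e"
        using xs(2) pos e by (intro add_left_mono mult_mono) (auto simp: pmf_le_1)
      finally have "C * ?E \<le> C * (1 + (M + 1) * e)"
        using pos by simp
      also have "\<dots> = C + (2 * real k - C) / 2"
      proof -
        have "M + 1 \<noteq> 0" using pos by simp
        then have "C * ((M + 1) * e) = (2 * real k - C) / 2"
          using pos(1) unfolding e_def by simp
        then show ?thesis by (simp add: distrib_left)
      qed
      also have "\<dots> < 2 * real k" using pos(2) by (simp add: field_simps)
      finally have "C * ?E < 2 * real k" .
      moreover have "c * ?E \<le> C * ?E" by (intro mult_right_mono) (auto simp: C_def)
      moreover have "2 * real k \<le> real (opt xs)" using opt_ge[of T xs] T xs by simp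
      ultimately show False using bound[OF inst] by linarith
    qed
  qed
  show "\<forall>p. 0 < p \<and> p \<le> 1 \<longrightarrow>
      (\<exists>\<epsilon>>0. \<exists>xs. is_instance k xs \<and> prob_ratio_greater F xs (2 * real k - \<epsilon>) \<ge> p)"
  proof (intro allI impI)
    fix p :: real assume p: "0 < p \<and> p \<le> 1"
    \<comment> \<open>\<open>\<epsilon>\<close> may depend on \<open>p\<close> and exceed \<open>2 * k\<close>, and ratios are never negative.\<close>
    have "ratio [?I] S > ereal (2 * real k - (2 * real k + 1))" for S
    proof -
      have "0 \<le> ratio [?I] S" by (auto simp: ratio_def divide_ereal_def ereal_inverse_nonneg_iff)
      then show ?thesis by (simp add: less_le_trans[of _ 0])
    qed
    then have "prob_ratio_greater F [?I] (2 * real k - (2 * real k + 1)) = 1"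
      unfolding prob_ratio_greater_def by simp
    then show "\<exists>\<epsilon>>0. \<exists>xs. is_instance k xs \<and> prob_ratio_greater F xs (2 * real k - \<epsilon>) \<ge> p"
      using inst1 p by (intro exI[of _ "2 * real k + 1"] conjI exI[of _ "[?I]"]) auto
  qed
  show "\<forall>p \<epsilon>. 0 < p \<and> p < 1 \<and> 0 < \<epsilon> \<longrightarrow>
      (\<exists>xs. is_instance k xs \<and> prob_ratio_greater F xs (2 * real k - \<epsilon>) \<ge> p)"
  proof (intro allI impI)
    fix p \<epsilon> :: real assume p: "0 < p \<and> p < 1 \<and> 0 < \<epsilon>"
    show "\<exists>xs. is_instance k xs \<and> prob_ratio_greater F xs (2 * real k - \<epsilon>) \<ge> p"
    proof (cases "F ?I {} = 0")
      case True
      \<comment> \<open>A positive extended real divided by 0 is infinite.\<close>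
      have "ratio [?I] {} = \<infinity>" using opt1 by (simp add: ratio_def)
      then have "prob_ratio_greater F [?I] (2 * real k - \<epsilon>) = 1"
        unfolding prob_ratio_greater_def zero[OF True] by (simp add: measure_return_pmf)
      then show ?thesis using inst1 p by (intro exI[of _ "[?I]"]) auto
    next
      case False
      then obtain V I T where V: "reach F V I" "\<forall>K\<in>V. fst K < snd K"
        "card (interval_length ` V) \<le> k" and T: "T \<subseteq> V" "separated T" "2 * k \<le> card T"
        using win by blast
      obtain xs where xs: "set xs = V" "p \<le> pmf (run F xs {}) {I}"
        using V(1) p unfolding reach_def by blast
      have "2 * k \<le> opt xs" using opt_ge[of T xs] T xs by simp
      then have "2 * real k - \<epsilon> < real (opt xs)" using p by linarith
      then have "{I} \<in> {S. ratio xs S > ereal (2 * real k - \<epsilon>)}"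
        by (simp add: ratio_def)
      then have "pmf (run F xs {}) {I} \<le> prob_ratio_greater F xs (2 * real k - \<epsilon>)"
        unfolding prob_ratio_greater_def final_solution_def measure_pmf_single[symmetric]
        by (intro measure_pmf.finite_measure_mono) auto
      then show ?thesis using xs V by (intro exI[of _ xs]) (auto simp: is_instance_def)
    qed
  qed
qed

end
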